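(* Let $n\ge 2$, let $P\in\mathbb{R}^{n\times n}$ with $\det P=1$, let $P=U\Sigma V^T$ be a singular value decomposition of $P$ with $\Sigma=\mathrm{diag}(\Sigma_1,\dots,\Sigma_n)$, and let $\lambda\in\mathbb{R}$. Suppose that $\lambda\ne\Sigma_i^2$ for $1\le i\le n$, that $\lambda\ne\pm\Sigma_i\Sigma_j$ for $1\le i\ne j\le n$, and that $\sum_{i=1}^n(\Sigma_i^2-\lambda)^{-1}\ne 0$. Then the linear system $$\delta Y+\lambda\bigl[\operatorname{tr}(\Sigma^{-1}\delta Y)\,\Sigma^{-1}-\Sigma^{-1}(\delta Y)^T\Sigma^{-1}\bigr]+\delta\eta\,\Sigma^{-1}=U^T\,\delta A\,V,\qquad \Sigma^{-1}:\delta Y=0,$$ for the unknowns $(\delta Y,\delta\eta)\in\mathbb{R}^{n\times n}\times\mathbb{R}$ is well posed, i.e., it has a unique solution for every $\delta A\in\mathbb{R}^{n\times n}$.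
   Context: $X:Y=\sum_{i,j=1}^n X_{ij}Y_{ij}$ denotes the Frobenius inner product of matrices. In a singular value decomposition $P=U\Sigma V^T$, the matrices $U,V\in\mathbb{R}^{n\times n}$ are orthogonal and $\Sigma$ is diagonal with nonnegative entries; since $\det P=1$, all $\Sigma_i$ are positive. *)

theory Defs
  imports "HOL-Analysis.Analysis"
begin

definition diag_matrix :: "real ^ 'n \<Rightarrow> real ^ 'n ^ 'n" where
  "diag_matrix s = (\<chi> i j. if i = j then s $ i else 0)"

text \<open>No ordering of the singular values is imposed.\<close>

definition is_svd ::
  "real ^ 'n ^ 'n \<Rightarrow> real ^ 'n ^ 'n \<Rightarrow> real ^ 'n \<Rightarrow> real ^ 'n ^ 'n \<Rightarrow> bool" where
  "is_svd P U s V \<longleftrightarrow>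
     orthogonal_matrix U \<and> orthogonal_matrix V \<and> (\<forall>i. 0 \<le> s $ i) \<and>
     P = U ** diag_matrix s ** transpose V"

text \<open>The Frobenius inner product is the standard inner product on the type of matrices.\<close>

lemma inner_matrix_eq_Frobenius:
  fixes X Y :: "real ^ 'n ^ 'n"
  shows "X \<bullet> Y = (\<Sum>i\<in>UNIV. \<Sum>j\<in>UNIV. X $ i $ j * Y $ i $ j)"
  by (simp add: inner_vec_def)

end

theory Submission
  imports Defs
begin

text \<open>Under the constraint \<open>\<Sigma>\<^sup>-\<^sup>1 : \<delta>Y = 0\<close> the trace term vanishes, so the system decouples: the entries
  \<open>(i, j)\<close> and \<open>(j, i)\<close> with \<open>i \<noteq> j\<close> satisfy a 2-by-2 system with determinant
  \<open>1 - (\<lambda> / (\<Sigma>\<^sub>i \<Sigma>\<^sub>j))\<^sup>2\<close>, and each diagonal entry is an affine function of \<open>\<delta>\<eta>\<close>. Inserting the diagonal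
  entries into the constraint gives a scalar equation for \<open>\<delta>\<eta>\<close> with the coefficient
  \<open>\<Sum>\<^sub>i (\<Sigma>\<^sub>i\<^sup>2 - \<lambda>)\<^sup>-\<^sup>1\<close>.\<close>

lemma diag_matrix_mult:
  "diag_matrix s ** M = (\<chi> i j. s $ i * M $ i $ j)"
  by (simp add: diag_matrix_def matrix_matrix_mult_def vec_eq_iff if_distrib[where f = "\<lambda>x. x * _"]
      cong: if_cong)

lemma mult_diag_matrix:
  "M ** diag_matrix s = (\<chi> i j. M $ i $ j * s $ j)"
  by (simp add: diag_matrix_def matrix_matrix_mult_def vec_eq_iff if_distrib[where f = "\<lambda>x. _ * x"]
      cong: if_cong)

lemma inner_diag_matrix: "diag_matrix s \<bullet> M = (\<Sum>i\<in>UNIV. s $ i * M $ i $ i)"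
  by (simp add: diag_matrix_def inner_vec_def if_distrib[where f = "\<lambda>x. x * _"] cong: if_cong)

lemma trace_diag_matrix_mult: "trace (diag_matrix s ** M) = diag_matrix s \<bullet> M"
  by (simp add: trace_def diag_matrix_mult inner_diag_matrix)

lemma det_diag_matrix: "det (diag_matrix s) = (\<Prod>i\<in>UNIV. s $ i)"
  by (subst det_diagonal) (simp_all add: diag_matrix_def)

text \<open>\<open>matrix_inv\<close> is a Hilbert choice of a two-sided inverse. The witness
  \<open>B\<close> makes the choice a genuine inverse, and associativity then forces it to equal
  \<open>B\<close>.\<close>

lemma matrix_inv_unique:
  fixes A :: "'a::semiring_1 ^ 'n ^ 'm"
  assumes "A ** B = mat 1" "B ** A = mat 1"
  shows "matrix_inv A = B"
proof -
  have inv: "A ** matrix_inv A = mat 1 \<and> matrix_inv A ** A = mat 1"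
    unfolding matrix_inv_def by (rule someI[of _ B]) (simp add: assms)
  have "matrix_inv A = matrix_inv A ** (A ** B)"
    by (simp add: assms(1))
  also have "\<dots> = B"
    by (simp add: inv matrix_mul_assoc)
  finally show ?thesis .
qed

lemma matrix_inv_diag_matrix:
  assumes "\<And>i. s $ i \<noteq> 0"
  shows "matrix_inv (diag_matrix s) = diag_matrix (\<chi> i. inverse (s $ i))"
  by (rule matrix_inv_unique)
    \<comment> \<open>The products are rewritten entrywise first, while the left factor still has
      the form \<open>diag_matrix _\<close>; only then is the remaining factor unfolded.\<close>
    (use assms in \<open>simp_all add: diag_matrix_mult\<close>,
      use assms in \<open>simp_all add: diag_matrix_def mat_def vec_eq_iff\<close>)

text \<open>The determinant is multiplicative, so a zero factor in the product of the
  \<open>s $ i\<close> would make \<open>det P\<close> vanish.\<close>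

lemma is_svd_nonzero:
  assumes "is_svd P U s V" "det P \<noteq> 0"
  shows "s $ i \<noteq> 0"
proof -
  have "det (diag_matrix s) \<noteq> 0"
    using assms by (auto simp: is_svd_def det_mul)
  then show ?thesis
    by (simp add: det_diag_matrix)
qed

text \<open>Cramer's rule: the coefficient matrix has determinant
  \<open>1 - k\<^sup>2\<close>.\<close>

lemma two_by_two_unique_solution:
  fixes k x y a b :: real
  assumes "k\<^sup>2 \<noteq> 1"
  shows "x - k * y = a \<and> y - k * x = b \<longleftrightarrow>
    x = (a + k * b) / (1 - k\<^sup>2) \<and> y = (b + k * a) / (1 - k\<^sup>2)"
proof -
  have "1 - k\<^sup>2 \<noteq> 0"
    using assms by simp
  then show ?thesis
    by (simp add: eq_divide_eq) (auto simp: field_simps power2_eq_square; algebra)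
qed

lemma diagonal_system_unique_solution:
  fixes s y b :: "real ^ 'n" and lam \<eta> :: real
  assumes s: "\<And>i. s $ i \<noteq> 0" and lam: "\<And>i. lam \<noteq> (s $ i)\<^sup>2"
    and sum: "(\<Sum>i\<in>UNIV. inverse ((s $ i)\<^sup>2 - lam)) \<noteq> 0"
  defines "\<eta>0 \<equiv> (\<Sum>i\<in>UNIV. s $ i * b $ i / ((s $ i)\<^sup>2 - lam)) /
    (\<Sum>i\<in>UNIV. inverse ((s $ i)\<^sup>2 - lam))"
  shows "(\<forall>i. y $ i - lam / (s $ i)\<^sup>2 * y $ i + \<eta> / s $ i = b $ i) \<and>
      (\<Sum>i\<in>UNIV. inverse (s $ i) * y $ i) = 0 \<longleftrightarrow>
    (\<forall>i. y $ i = s $ i * (s $ i * b $ i - \<eta>0) / ((s $ i)\<^sup>2 - lam)) \<and> \<eta> = \<eta>0"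
proof -
  \<comment> \<open>Multiplying by \<open>(s $ i)\<^sup>2\<close> turns the left equation into
    \<open>((s $ i)\<^sup>2 - lam) * y $ i = s $ i * (s $ i * b $ i - \<eta>)\<close>.\<close>
  have entry: "y $ i - lam / (s $ i)\<^sup>2 * y $ i + \<eta> / s $ i = b $ i \<longleftrightarrow>
      y $ i = s $ i * (s $ i * b $ i - \<eta>) / ((s $ i)\<^sup>2 - lam)" for i
  proof -
    have "(s $ i)\<^sup>2 - lam \<noteq> 0"
      using lam[of i] by simp
    then show ?thesis
      using s[of i] by (simp add: eq_divide_eq) (auto simp: field_simps power2_eq_square)
  qed
  \<comment> \<open>With \<open>y\<close> expressed through \<open>\<eta>\<close>, the constraint is
    affine in \<open>\<eta>\<close>, and \<open>\<eta>0\<close> is its only root.\<close>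
  have constraint: "(\<Sum>i\<in>UNIV. inverse (s $ i) * y $ i) = 0 \<longleftrightarrow> \<eta> = \<eta>0"
    if y: "\<forall>i. y $ i = s $ i * (s $ i * b $ i - \<eta>) / ((s $ i)\<^sup>2 - lam)"
  proof -
    have "inverse (s $ i) * y $ i =
        s $ i * b $ i / ((s $ i)\<^sup>2 - lam) - \<eta> * inverse ((s $ i)\<^sup>2 - lam)" for i
      unfolding y[rule_format, of i] using s[of i] lam[of i, symmetric] by (simp add: divide_simps)
    then have "(\<Sum>i\<in>UNIV. inverse (s $ i) * y $ i) =
        (\<Sum>i\<in>UNIV. s $ i * b $ i / ((s $ i)\<^sup>2 - lam)) -
          \<eta> * (\<Sum>i\<in>UNIV. inverse ((s $ i)\<^sup>2 - lam))"
      by (simp add: sum_subtractf sum_distrib_left)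
    then show ?thesis
      using sum by (auto simp: \<eta>0_def eq_divide_eq)
  qed
  show ?thesis
    unfolding entry using constraint by auto
qed

text \<open>Since \<open>k\<close> is symmetric, the equations at \<open>(i, j)\<close> and
  \<open>(j, i)\<close> form one 2-by-2 system with a common coefficient; the hypothesis on
  \<open>lam\<close> says that this coefficient is neither 1 nor -1.\<close>

lemma off_diagonal_system_unique_solution:
  fixes s :: "real ^ 'n" and Y B :: "real ^ 'n ^ 'n" and lam :: real
  assumes s: "\<And>i. s $ i \<noteq> 0"
    and lam: "\<And>i j. i \<noteq> j \<Longrightarrow> lam \<noteq> s $ i * s $ j \<and> lam \<noteq> - (s $ i * s $ j)"
  defines "k \<equiv> \<lambda>i j. lam / (s $ i * s $ j)"
  shows "(\<forall>i j. i \<noteq> j \<longrightarrow> Y $ i $ j - k i j * Y $ j $ i = B $ i $ j) \<longleftrightarrow>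
    (\<forall>i j. i \<noteq> j \<longrightarrow> Y $ i $ j = (B $ i $ j + k i j * B $ j $ i) / (1 - (k i j)\<^sup>2))"
proof -
  have sym: "k j i = k i j" for i j
    by (simp add: k_def mult.commute)
  have "(k i j)\<^sup>2 \<noteq> 1" if "i \<noteq> j" for i j
    unfolding power2_eq_1_iff k_def
    using s[of i] s[of j] lam[OF that] by (simp add: divide_eq_eq)
  \<comment> \<open>Only the pair of equations is equivalent to the pair of solved forms;
    quantifying over all ordered pairs supplies both members.\<close>
  then have "Y $ i $ j - k i j * Y $ j $ i = B $ i $ j \<and> Y $ j $ i - k j i * Y $ i $ j = B $ j $ i \<longleftrightarrow>
      Y $ i $ j = (B $ i $ j + k i j * B $ j $ i) / (1 - (k i j)\<^sup>2) \<and>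
      Y $ j $ i = (B $ j $ i + k j i * B $ i $ j) / (1 - (k j i)\<^sup>2)" if "i \<noteq> j" for i j
    using two_by_two_unique_solution that by (simp add: sym[of j i])
  then show ?thesis
    by metis
qed

theorem theorem7p8:
  fixes P U V :: "real ^ 'n ^ 'n" and s :: "real ^ 'n" and lam :: real
  assumes "CARD('n) \<ge> 2"
    and "det P = 1"
    and "is_svd P U s V"
    and "\<And>i. lam \<noteq> (s $ i)\<^sup>2"
    and "\<And>i j. i \<noteq> j \<Longrightarrow> lam \<noteq> s $ i * s $ j \<and> lam \<noteq> - (s $ i * s $ j)"
    and "(\<Sum>i\<in>UNIV. inverse ((s $ i)\<^sup>2 - lam)) \<noteq> 0"
  shows "\<forall>\<delta>A :: real ^ 'n ^ 'n. \<exists>!z :: (real ^ 'n ^ 'n) \<times> real.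
    case z of (\<delta>Y, \<delta>\<eta>) \<Rightarrow>
      (let Sinv = matrix_inv (diag_matrix s) in
        \<delta>Y + lam *\<^sub>R (trace (Sinv ** \<delta>Y) *\<^sub>R Sinv - Sinv ** transpose \<delta>Y ** Sinv)
            + \<delta>\<eta> *\<^sub>R Sinv = transpose U ** \<delta>A ** V
        \<and> Sinv \<bullet> \<delta>Y = 0)"
proof
  fix \<delta>A :: "real ^ 'n ^ 'n"
  define B where "B = transpose U ** \<delta>A ** V"
  define T where "T = diag_matrix (\<chi> i. inverse (s $ i))"
  define k where "k = (\<lambda>i j. lam / (s $ i * s $ j))"
  define \<eta>0 where "\<eta>0 = (\<Sum>i\<in>UNIV. s $ i * B $ i $ i / ((s $ i)\<^sup>2 - lam)) /
    (\<Sum>i\<in>UNIV. inverse ((s $ i)\<^sup>2 - lam))"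
  \<comment> \<open>The candidate solution: its diagonal comes from the diagonal system at
    \<open>\<eta>0\<close>, the other entries from Cramer's rule.\<close>
  define Y0 :: "real ^ 'n ^ 'n" where "Y0 = (\<chi> i j.
    if i = j then s $ i * (s $ i * B $ i $ i - \<eta>0) / ((s $ i)\<^sup>2 - lam)
    else (B $ i $ j + k i j * B $ j $ i) / (1 - (k i j)\<^sup>2))"
  have s: "s $ i \<noteq> 0" for i
    using is_svd_nonzero[OF assms(3)] assms(2) by simp
  have inv: "matrix_inv (diag_matrix s) = T"
    unfolding T_def using s by (rule matrix_inv_diag_matrix)
  have "Y + lam *\<^sub>R (trace (T ** Y) *\<^sub>R T - T ** transpose Y ** T) + \<eta> *\<^sub>R T = B \<and> T \<bullet> Y = 0 \<longleftrightarrow>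
      Y = Y0 \<and> \<eta> = \<eta>0" for Y \<eta>
  proof -
    have "Y + lam *\<^sub>R (trace (T ** Y) *\<^sub>R T - T ** transpose Y ** T) + \<eta> *\<^sub>R T = B \<and> T \<bullet> Y = 0 \<longleftrightarrow>
        (\<forall>i j. Y $ i $ j - k i j * Y $ j $ i + (if i = j then \<eta> / s $ i else 0) = B $ i $ j) \<and>
        T \<bullet> Y = 0"
    \<comment> \<open>This congruence allows the constraint to be assumed while the matrix equation
      is rewritten. As \<open>T\<close> is diagonal, \<open>trace (T ** Y)\<close> equals
      \<open>T \<bullet> Y\<close> and so vanishes.\<close>
    proof (intro rev_conj_cong refl)
      assume "T \<bullet> Y = 0"
      then have "trace (T ** Y) = 0"
        by (simp add: T_def trace_diag_matrix_mult)
      moreover have "(T ** transpose Y ** T) $ i $ j = Y $ j $ i / (s $ i * s $ j)" for i j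
        by (simp add: T_def diag_matrix_mult mult_diag_matrix transpose_def divide_inverse)
      moreover have "T $ i $ j = (if i = j then 1 / s $ i else 0)" for i j
        by (simp add: T_def diag_matrix_def divide_inverse)
      ultimately show "Y + lam *\<^sub>R (trace (T ** Y) *\<^sub>R T - T ** transpose Y ** T) + \<eta> *\<^sub>R T = B \<longleftrightarrow>
          (\<forall>i j. Y $ i $ j - k i j * Y $ j $ i + (if i = j then \<eta> / s $ i else 0) = B $ i $ j)"
        by (simp add: vec_eq_iff k_def if_distrib[where f = "\<lambda>x. \<eta> * x"] cong: if_cong)
    qed
    also have "\<dots> \<longleftrightarrow>
        ((\<forall>i. Y $ i $ i - lam / (s $ i)\<^sup>2 * Y $ i $ i + \<eta> / s $ i = B $ i $ i) \<and>
          (\<Sum>i\<in>UNIV. inverse (s $ i) * Y $ i $ i) = 0) \<and>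
        (\<forall>i j. i \<noteq> j \<longrightarrow> Y $ i $ j - k i j * Y $ j $ i = B $ i $ j)"
    proof -
      have diag: "k i i = lam / (s $ i)\<^sup>2" for i
        by (simp add: k_def power2_eq_square)
      \<comment> \<open>Separating the index pairs with \<open>i = j\<close> decouples the system;
        \<open>\<eta>\<close> and the constraint involve only the diagonal part.\<close>
      have split: "(\<forall>i j. Q i j) \<longleftrightarrow> (\<forall>i. Q i i) \<and> (\<forall>i j. i \<noteq> j \<longrightarrow> Q i j)"
        for Q :: "'n \<Rightarrow> 'n \<Rightarrow> bool"
        by metis
      show ?thesis
        by (subst split) (simp add: diag T_def inner_diag_matrix conj_ac cong: imp_cong)
    qed
    also have "\<dots> \<longleftrightarrow>
        ((\<forall>i. Y $ i $ i = s $ i * (s $ i * B $ i $ i - \<eta>0) / ((s $ i)\<^sup>2 - lam)) \<and> \<eta> = \<eta>0) \<and>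
        (\<forall>i j. i \<noteq> j \<longrightarrow> Y $ i $ j = (B $ i $ j + k i j * B $ j $ i) / (1 - (k i j)\<^sup>2))"
      using diagonal_system_unique_solution[OF s assms(4,6),
          where y = "\<chi> i. Y $ i $ i" and b = "\<chi> i. B $ i $ i" and \<eta> = \<eta>]
        off_diagonal_system_unique_solution[OF s assms(5), where Y = Y and B = B]
      by (simp add: \<eta>0_def k_def)
    also have "\<dots> \<longleftrightarrow> Y = Y0 \<and> \<eta> = \<eta>0"
      by (auto simp: Y0_def vec_eq_iff)
    finally show ?thesis .
  qed
  \<comment> \<open>The equivalence identifies the solution set as the singleton of
    \<open>(Y0, \<eta>0)\<close>, which gives existence and uniqueness at once.\<close>
  then show "\<exists>!z :: (real ^ 'n ^ 'n) \<times> real.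
    case z of (\<delta>Y, \<delta>\<eta>) \<Rightarrow>
      (let Sinv = matrix_inv (diag_matrix s) in
        \<delta>Y + lam *\<^sub>R (trace (Sinv ** \<delta>Y) *\<^sub>R Sinv - Sinv ** transpose \<delta>Y ** Sinv)
            + \<delta>\<eta> *\<^sub>R Sinv = transpose U ** \<delta>A ** V
        \<and> Sinv \<bullet> \<delta>Y = 0)"
    by (simp add: inv Let_def flip: B_def) auto
qed

end
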